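(* There exists a measurable exponent $p:[0,1]\to[1,+\infty)$ with $1<p_-\le p_+<\infty$ and $1/p(\cdot)\in BLO^{1/\log}$ such that $p(\cdot)\notin\mathcal{B}$, i.e. the Hardy–Littlewood maximal operator $M$ is not bounded on $L^{p(\cdot)}[0,1]$.
   Context: For a measurable function (exponent) $p:[0,1]\to[1,+\infty)$, $L^{p(\cdot)}[0,1]$ is the set of measurable functions $f$ on $[0,1]$ such that $\int_{[0,1]}(|f(x)|/\lambda)^{p(x)}dx<\infty$ for some $\lambda>0$, with norm $\|f\|_{p(\cdot)}=\inf\{\lambda>0:\int_{[0,1]}(|f(x)|/\lambda)^{p(x)}dx\le 1\}$. Write $p_-=\operatorname{ess\,inf}_{x\in[0,1]}p(x)$ and $p_+=\operatorname{ess\,sup}_{x\in[0,1]}p(x)$. The Hardy–Littlewood maximal operator is defined for $f\in L^1[0,1]$ by $Mf(x)=\sup_{Q\ni x}\frac{1}{|Q|}\int_Q|f(t)|\,dt$, where the supremum is over all intervals $Q\subset[0,1]$ (of positive length) containing $x$; sets like $[0,a)$ and $(a,1]$ also count as intervals. $\mathcal{B}$ denotes the class of all measurable exponents $p(\cdot)$ with $1<p_-\le p_+<\infty$ for which $M$ is bounded on $L^{p(\cdot)}[0,1]$. For $f\in L^1[0,1]$ put $\eta(f,r)=\sup_{|Q|\le r}\left(f_Q-\operatorname{ess\,inf}_{x\in Q}f(x)\right)$ for $0<r\le 1$, where the supremum is over all intervals $Q\subset[0,1]$ with $|Q|\le r$ and $f_Q=\frac{1}{|Q|}\int_Q f(x)\,dx$.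 We say $f\in BLO^{1/\log}$ if there is a constant $C>0$ such that $\eta(f,r)\le C/\log(e+1/r)$ for all $0<r\le1$. *)

theory Defs
  imports "HOL-Analysis.Analysis" "HOL-Probability.Essential_Supremum"
begin

text \<open>Functions on $[0,1]$ are represented by functions on the reals whose values outside
  \<open>{0..1}\<close> are irrelevant; measurability is Lebesgue measurability on \<open>{0..1}\<close>.\<close>

abbreviation leb01 :: "real measure" where
  "leb01 \<equiv> lebesgue_on {0..1}"

definition essinf :: "'a measure \<Rightarrow> ('a \<Rightarrow> ereal) \<Rightarrow> ereal" where
  "essinf M f = - esssup M (\<lambda>x. - f x)"

definition exponent :: "(real \<Rightarrow> real) \<Rightarrow> bool" where
  "exponent p \<longleftrightarrow> p \<in> borel_measurable leb01 \<and> (\<forall>x\<in>{0..1}. 1 \<le> p x)"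

definition p_minus :: "(real \<Rightarrow> real) \<Rightarrow> ereal" where
  "p_minus p = essinf leb01 (\<lambda>x. ereal (p x))"

definition p_plus :: "(real \<Rightarrow> real) \<Rightarrow> ereal" where
  "p_plus p = esssup leb01 (\<lambda>x. ereal (p x))"

definition modular :: "(real \<Rightarrow> real) \<Rightarrow> (real \<Rightarrow> real) \<Rightarrow> ennreal" where
  "modular p f = (\<integral>\<^sup>+x. ennreal (\<bar>f x\<bar> powr p x) \<partial>leb01)"

definition Lp_var :: "(real \<Rightarrow> real) \<Rightarrow> (real \<Rightarrow> real) set" where
  "Lp_var p = {f \<in> borel_measurable leb01. \<exists>c>0. modular p (\<lambda>x. \<bar>f x\<bar> / c) < \<infinity>}"

text \<open>Only meaningful for \<open>f \<in> Lp_var p\<close>: otherwise the set below may be empty.\<close>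
definition Lp_var_norm :: "(real \<Rightarrow> real) \<Rightarrow> (real \<Rightarrow> real) \<Rightarrow> real" where
  "Lp_var_norm p f = Inf {c. 0 < c \<and> modular p (\<lambda>x. \<bar>f x\<bar> / c) \<le> 1}"

text \<open>Open, closed and half-open intervals are all allowed.\<close>
definition subintervals :: "real set set" where
  "subintervals = {Q. is_interval Q \<and> Q \<subseteq> {0..1} \<and> 0 < measure lebesgue Q}"

definition maximal_fun :: "(real \<Rightarrow> real) \<Rightarrow> real \<Rightarrow> ennreal" where
  "maximal_fun f x =
     (SUP Q\<in>{Q \<in> subintervals. x \<in> Q}.
        (\<integral>\<^sup>+t. ennreal \<bar>f t\<bar> \<partial>lebesgue_on Q) / emeasure lebesgue Q)"

text \<open>The maximal function may be infinite at individual points, while the elements of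
  \<open>Lp_var p\<close> are real-valued. That it belongs to the space therefore means that it is
  finite almost everywhere and that its real-valued version is in \<open>Lp_var p\<close>; without the
  former condition, \<open>enn2real\<close> would silently replace infinite values by 0.\<close>
definition maximal_bounded :: "(real \<Rightarrow> real) \<Rightarrow> bool" where
  "maximal_bounded p \<longleftrightarrow>
     (\<exists>C>0. \<forall>f\<in>Lp_var p.
        (AE x in leb01. maximal_fun f x < \<infinity>) \<and>
        (\<lambda>x. enn2real (maximal_fun f x)) \<in> Lp_var p \<and>
        Lp_var_norm p (\<lambda>x. enn2real (maximal_fun f x)) \<le> C * Lp_var_norm p f)"

definition class_B :: "(real \<Rightarrow> real) set" where
  "class_B = {p. exponent p \<and> 1 < p_minus p \<and> p_minus p \<le> p_plus p \<and> p_plus p < \<infinity> \<and>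
     maximal_bounded p}"

definition avg :: "(real \<Rightarrow> real) \<Rightarrow> real set \<Rightarrow> real" where
  "avg f Q = (\<integral>x. f x \<partial>lebesgue_on Q) / measure lebesgue Q"

text \<open>Extended-real valued, as the oscillation is infinite if \<open>f\<close> is not essentially bounded
  below.\<close>
definition eta :: "(real \<Rightarrow> real) \<Rightarrow> real \<Rightarrow> ereal" where
  "eta f r =
     (SUP Q\<in>{Q \<in> subintervals. measure lebesgue Q \<le> r}.
        ereal (avg f Q) - essinf (lebesgue_on Q) (\<lambda>x. ereal (f x)))"

definition BLO_log :: "(real \<Rightarrow> real) set" where
  "BLO_log = {f. integrable leb01 f \<and>
     (\<exists>C>0. \<forall>r. 0 < r \<and> r \<le> 1 \<longrightarrow> eta f r \<le> ereal (C / ln (exp 1 + 1 / r)))}"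

end

theory Submission
  imports Defs
begin

text \<open>The exponent has the form \<open>1 / p x = G (ln (1 - ln x))\<close> with \<open>G\<close> nondecreasing,
  Lipschitz, and with values between \<open>1/4\<close> and \<open>3/4\<close>.  In the variable \<open>u = 1 - ln x\<close> write
  \<open>h u = G (ln u)\<close>.

  Such a function is always in \<open>BLO_log\<close> (lemma \<open>BLO_log_comp_lnln\<close>).  It is nonincreasing in
  \<open>x > 0\<close>, so that its infimum over an interval is essentially the value at the right endpoint
  \<open>b\<close>, and the excess over that value at \<open>x\<close> is at most a multiple of
  \<open>ln (b / x) / (1 - ln b)\<close>.  Averaging over an interval of length \<open>d\<close> gains a factor \<open>d / b\<close>,
  and this turns \<open>1 / (1 - ln b)\<close> into \<open>1 / ln (exp 1 + 1 / d)\<close>.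

  Boundedness of the maximal operator imposes more.  Test it on the indicator of an interval
  from \<open>0\<close> to \<open>exp (1 - v)\<close>.  Its norm is at most \<open>exp ((1 - v) * h v)\<close>, because \<open>1 / p\<close> is at
  least \<open>h v\<close> on the interval.  For \<open>2 \<le> u \<le> v\<close>, on the larger interval from \<open>0\<close> to
  \<open>exp (2 - u)\<close>, its maximal function is at least \<open>exp (u - v - 1)\<close>; and on the part beyond
  \<open>exp (1 - u)\<close>, where \<open>1 / p\<close> is at most \<open>h u\<close>, this bound alone contributes a norm of at
  least \<open>exp (u - v - 1 + (1 - u) * h u)\<close>.  Comparing the two, the function
  \<open>\<phi> u = u * (1 - h u)\<close> can decrease by at most a constant from \<open>u\<close> to any later \<open>v\<close>
  (lemma \<open>maximal_bounded_imp_bounded_drop\<close>).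

  The derivative of \<open>\<phi>\<close> is \<open>1 - h u - u * h' u\<close>, and \<open>u * h' u\<close> is the slope of \<open>G\<close> at \<open>ln u\<close>.
  Hence \<open>\<phi>\<close> decreases wherever \<open>G\<close> has slope \<open>4\<close>.  Boundedness of \<open>G\<close> only limits the total
  amount of climbing: let \<open>G\<close> climb by \<open>(1/2) ^ n / 4\<close> with slope \<open>4\<close> just after \<open>n\<close> and
  be constant until \<open>n + 1\<close>.  As \<open>u\<close> is about \<open>exp n\<close> there, \<open>\<phi>\<close> drops by a fixed multiple of
  \<open>(exp 1 / 2) ^ n\<close> at least, which is unbounded (lemma \<open>climb_drop\<close>).\<close>

section \<open>A bounded Lipschitz staircase\<close>

lemma exp_one_ge: "5/2 \<le> exp (1::real)"
  using exp_lower_Taylor_quadratic[of "1::real"] by simp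

definition level :: "nat \<Rightarrow> real" where
  "level n = 3/4 - (1/2) ^ Suc n"

text \<open>A staircase with plateaus at the heights \<open>level n\<close>, joined by ramps of slope \<open>4\<close> that start
  at the integers. As a supremum of truncated ramps it inherits monotonicity and the Lipschitz
  constant from the single ramps, so no case distinction over the pieces is necessary.\<close>

definition climb :: "real \<Rightarrow> real" where
  "climb s = (SUP n. min (level (Suc n)) (level n + 4 * (s - real n)))"

lemma level_bounds: "1/4 \<le> level n" "level n \<le> 3/4"
proof -
  have "(1/2::real) ^ n \<le> 1" by (simp add: power_le_one)
  then show "1/4 \<le> level n" "level n \<le> 3/4" by (auto simp: level_def)
qed

lemma level_mono: "m \<le> n \<Longrightarrow> level m \<le> level n"
  unfolding level_def using power_decreasing[of "Suc m" "Suc n" "1/2::real"] by simp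

lemma level_Suc: "level (Suc n) = level n + (1/2) ^ n / 4"
  by (simp add: level_def field_simps)

lemma bdd_above_climb: "bdd_above (range (\<lambda>n. min (level (Suc n)) (level n + 4 * (s - real n))))"
  by (rule bdd_aboveI2[where M = "3/4"]) (rule min.coboundedI1, rule level_bounds)

lemma climb_ge: "min (level (Suc n)) (level n + 4 * (s - real n)) \<le> climb s"
  unfolding climb_def by (rule cSUP_upper[OF _ bdd_above_climb]) simp

lemma climb_leI:
  "(\<And>n. min (level (Suc n)) (level n + 4 * (s - real n)) \<le> c) \<Longrightarrow> climb s \<le> c"
  unfolding climb_def by (rule cSUP_least) auto

lemma mono_climb: "mono climb"
proof (rule monoI, rule climb_leI)
  fix s t :: real and n assume "s \<le> t"
  then have "min (level (Suc n)) (level n + 4 * (s - real n))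
      \<le> min (level (Suc n)) (level n + 4 * (t - real n))" by simp
  also have "\<dots> \<le> climb t" by (rule climb_ge)
  finally show "min (level (Suc n)) (level n + 4 * (s - real n)) \<le> climb t" .
qed

lemma climb_lipschitz: assumes "s \<le> t" shows "climb t \<le> climb s + 4 * (t - s)"
proof (rule climb_leI)
  fix n
  have "min (level (Suc n)) (level n + 4 * (t - real n))
      \<le> min (level (Suc n)) (level n + 4 * (s - real n)) + 4 * (t - s)"
    using assms by (auto simp: min_def)
  also have "\<dots> \<le> climb s + 4 * (t - s)" using climb_ge[of n s] by simp
  finally show "min (level (Suc n)) (level n + 4 * (t - real n)) \<le> climb s + 4 * (t - s)" .
qed

lemma climb_le: "climb s \<le> 3/4"
  by (rule climb_leI) (rule min.coboundedI1, rule level_bounds)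

lemma climb_ge_quarter: assumes "0 \<le> s" shows "1/4 \<le> climb s"
proof -
  have "1/4 \<le> min (level (Suc 0)) (level 0 + 4 * (s - real 0))"
    using assms level_bounds[of 0] level_bounds[of "Suc 0"] by (simp add: min_def)
  also have "\<dots> \<le> climb s" by (rule climb_ge)
  finally show ?thesis .
qed

text \<open>The ramps that begin later do not interfere at \<open>n\<close>: they have slope \<open>4\<close>, so one unit before
  their start they are far below \<open>level 0\<close>.\<close>

lemma climb_before: "climb (real n) \<le> level n"
proof (rule climb_leI)
  fix k
  consider "k < n" | "k = n" | "n < k" by linarith
  then show "min (level (Suc k)) (level k + 4 * (real n - real k)) \<le> level n"
  proof cases
    case 1
    then show ?thesis using level_mono[of "Suc k" n] by (simp add: min.coboundedI1)
  next
    case 3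
    then have "real k - real n \<ge> 1" by linarith
    then show ?thesis using level_bounds[of k] level_bounds[of n] by simp
  qed simp
qed

lemma climb_after: "level (Suc n) \<le> climb (real n + (1/2) ^ n / 16)"
  using climb_ge[of n "real n + (1/2) ^ n / 16"] by (simp add: level_Suc)

text \<open>Across the ramp at \<open>n\<close>, of height \<open>e = (1/2) ^ n / 4\<close> and length \<open>e / 4\<close>, the factor
  \<open>1 - climb\<close> loses \<open>e\<close>, whereas \<open>exp\<close> grows only by a factor of about \<open>1 + e / 4\<close>. So the
  product drops by at least \<open>exp n * e / 2\<close>, which is \<open>(exp 1 / 2) ^ n / 8\<close>.\<close>

lemma climb_drop:
  fixes K :: real
  obtains s t where "1 \<le> s" "s \<le> t" "K < exp s * (1 - climb s) - exp t * (1 - climb t)"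
proof -
  have "2 < exp (1::real)" using exp_one_ge by simp
  then obtain m where m: "8 * K < (exp 1 / 2) ^ m"
    using real_arch_pow[of "exp 1 / 2" "8 * K"] by auto
  \<comment> \<open>The successor ensures that the ramp starts at or after 1.\<close>
  define n where "n = Suc m"
  have n: "8 * K < (exp 1 / 2) ^ n"
    using \<open>2 < exp (1::real)\<close>
    by (intro less_le_trans[OF m] power_increasing) (auto simp: n_def)
  define e :: real where "e = (1/2) ^ n / 4"
  have e: "0 < e" "e \<le> 1/4" by (auto simp: e_def power_le_one)
  define a where "a = level n"
  have a: "1/4 \<le> a" "a + e \<le> 3/4" "a + e = level (Suc n)"
    using level_bounds[of n] level_bounds[of "Suc n"] by (auto simp: a_def e_def level_Suc)
  have "exp (real n + e / 4) * (1 - climb (real n + e / 4)) \<le> exp (real n + e / 4) * (1 - a - e)"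
    using climb_after[of n] a by (simp add: e_def)
  also have "\<dots> = exp (real n) * (exp (e / 4) * (1 - a - e))" by (simp add: exp_add)
  also have "\<dots> \<le> exp (real n) * ((1 + e / 2) * (1 - a - e))"
    using real_exp_bound_lemma[of "e / 4"] e a by (intro mult_left_mono mult_right_mono) auto
  also have "(1 + e / 2) * (1 - a - e) \<le> 1 - a - e / 2"
  proof -
    have "0 \<le> e * a" "0 \<le> e * e" using e a by auto
    then show ?thesis by (simp add: algebra_simps)
  qed
  finally have 1: "exp (real n + e / 4) * (1 - climb (real n + e / 4))
      \<le> exp (real n) * (1 - a - e / 2)" by simp
  have "exp (real n) * (1 - a) \<le> exp (real n) * (1 - climb (real n))"
    using climb_before[of n] by (simp add: a_def)
  moreover have "K < exp (real n) * (e / 2)"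
    using n exp_of_nat_mult[of n "1::real"] by (simp add: e_def power_divide field_simps)
  ultimately have "K < exp (real n) * (1 - climb (real n))
      - exp (real n + e / 4) * (1 - climb (real n + e / 4))"
    using 1 unfolding right_diff_distrib[of "exp (real n)"] by linarith
  then show ?thesis using that[of "real n" "real n + e / 4"] e by (simp add: n_def)
qed

section \<open>The iterated logarithm as a coordinate on the unit interval\<close>

definition lnln :: "real \<Rightarrow> real" where
  "lnln x = ln (1 - ln x)"

lemma lnln_nonneg: "0 \<le> x \<Longrightarrow> x \<le> 1 \<Longrightarrow> 0 \<le> lnln x"
  by (cases "x = 0") (auto simp: lnln_def)

lemma lnln_antimono: "0 < x \<Longrightarrow> x \<le> y \<Longrightarrow> y \<le> 1 \<Longrightarrow> lnln y \<le> lnln x"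
  unfolding lnln_def
  using ln_le_zero_iff[of y] ln_le_cancel_iff[of x y] by (intro ln_mono) linarith+

lemma lnln_exp: "lnln (exp (1 - exp s)) = s"
  by (simp add: lnln_def)

lemma borel_measurable_mono_lnln:
  assumes "mono (G :: real \<Rightarrow> real)"
  shows "(\<lambda>x. G (lnln x)) \<in> borel_measurable borel"
proof -
  note borel_measurable_mono[OF assms, measurable]
  show ?thesis unfolding lnln_def by measurable
qed

section \<open>Oscillation of monotone Lipschitz functions of the iterated logarithm\<close>

text \<open>The natural bound is \<open>ln (b / x) / (1 - ln b)\<close>, by concavity of the logarithm. Replacing
  \<open>ln y\<close> by \<open>2 * (sqrt y - 1)\<close> keeps the order of vanishing at \<open>y = 1\<close> and gives an
  integrand whose antiderivative is continuous down to \<open>0\<close>.\<close>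

lemma lnln_diff_le:
  assumes "0 < x" "x \<le> b" "b \<le> 1"
  shows "lnln x - lnln b \<le> 2 * (sqrt (b / x) - 1) / (1 - ln b)"
proof -
  define w where "w = 1 - ln b"
  have w: "1 \<le> w" using assms by (simp add: w_def)
  have lnx: "ln x \<le> ln b" using assms by simp
  have "lnln x - lnln b = ln ((1 - ln x) / w)"
    using w lnx by (subst ln_div) (auto simp: lnln_def w_def)
  also have "\<dots> \<le> (1 - ln x) / w - 1"
    using w lnx by (intro ln_le_minus_one) (auto simp: w_def intro!: divide_pos_pos)
  also have "\<dots> = ln (b / x) / w"
    using w assms unfolding divide_diff_eq_iff[of w "1 - ln x" 1]
    by (subst divide_diff_eq_iff) (simp_all add: ln_div, simp add: w_def)
  also have "ln (b / x) = 2 * ln (sqrt (b / x))" using assms by (simp add: ln_sqrt)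
  also have "\<dots> / w \<le> 2 * (sqrt (b / x) - 1) / w"
    using w assms by (intro divide_right_mono mult_left_mono ln_le_minus_one) auto
  finally show ?thesis by (simp add: w_def)
qed

lemma has_integral_sqrt_quotient:
  assumes "0 \<le> a" "a < b"
  shows "((\<lambda>x. 2 * (sqrt (b / x) - 1)) has_integral
    (b - a) * (2 * (sqrt b - sqrt a) / (sqrt b + sqrt a))) {a<..<b}"
proof -
  define F where "F x = 4 * sqrt b * sqrt x - 2 * x" for x
  have "((\<lambda>x. 2 * (sqrt (b / x) - 1)) has_integral (F b - F a)) {a..b}"
  proof (rule fundamental_theorem_of_calculus_interior)
    show "continuous_on {a..b} F" unfolding F_def by (intro continuous_intros)
    show "(F has_vector_derivative 2 * (sqrt (b / x) - 1)) (at x)" if "x \<in> {a<..<b}" for x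
      unfolding F_def has_real_derivative_iff_has_vector_derivative[symmetric]
      using that assms by (auto intro!: derivative_eq_intros simp: real_sqrt_divide field_simps)
  qed (use assms in simp)
  moreover have "F b - F a = (b - a) * (2 * (sqrt b - sqrt a) / (sqrt b + sqrt a))"
  proof -
    define s t where "s = sqrt b" and "t = sqrt a"
    have st: "b = s\<^sup>2" "a = t\<^sup>2" "0 < s" "0 \<le> t" using assms by (auto simp: s_def t_def)
    have "F b - F a = 2 * (s - t)\<^sup>2"
      unfolding F_def using st by (simp add: power2_eq_square algebra_simps)
    also have "\<dots> = (b - a) * (2 * (s - t) / (s + t))"
      using st by (simp add: field_simps power2_eq_square)
    finally show ?thesis by (simp add: s_def t_def)
  qed
  ultimately show ?thesis by (simp add: has_integral_Icc_iff_Ioo)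
qed

lemma ln_exp_one_add_pos:
  assumes "0 < (y::real)"
  shows "0 < ln (exp 1 + 1 / y)"
proof -
  have "0 < 1 / y" using assms by simp
  then show ?thesis using exp_one_ge by (intro ln_gt_zero) linarith
qed

text \<open>With \<open>s = (b - a) / b\<close>, the average computed above is at most \<open>2 * s\<close>. The logarithm of
  \<open>1 / (b - a)\<close> exceeds that of \<open>1 / b\<close> by \<open>- ln s\<close>, and \<open>- s * ln s\<close> is bounded; so the
  factor \<open>s\<close> pays for passing from the position \<open>b\<close> of the interval to its length.\<close>

lemma normalized_oscillation_le:
  assumes "0 \<le> a" "a < b" "b \<le> 1"
  shows "2 * (sqrt b - sqrt a) / (sqrt b + sqrt a) / (1 - ln b) \<le> 6 / ln (exp 1 + 1 / (b - a))"
proof -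
  define s where "s = (b - a) / b"
  have s: "0 < s" "s \<le> 1" "b - a = s * b" using assms by (auto simp: s_def)
  have w: "1 \<le> 1 - ln b" using assms by simp
  have "2 * (sqrt b - sqrt a) / (sqrt b + sqrt a) \<le> 2 * s"
  proof -
    define v t where "v = sqrt b" and "t = sqrt a"
    have st: "b = v\<^sup>2" "a = t\<^sup>2" "0 < v" "0 \<le> t" "t < v" using assms by (auto simp: v_def t_def)
    have "v\<^sup>2 \<le> (v + t)\<^sup>2" using st by (intro power_mono) auto
    then have "(v - t) * v\<^sup>2 \<le> (v - t) * (v + t)\<^sup>2" using st by (intro mult_left_mono) auto
    then have "(v - t) / (v + t) \<le> (v\<^sup>2 - t\<^sup>2) / v\<^sup>2"
      using st by (simp add: field_simps power2_eq_square)
    then show ?thesis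
      unfolding s_def v_def[symmetric] t_def[symmetric] unfolding st(1,2) by linarith
  qed
  moreover have "s * ln (exp 1 + 1 / (b - a)) \<le> 3 * (1 - ln b)"
  proof -
    have "exp 1 * (b - a) + 1 \<le> exp 1 + (1::real)" using assms by simp
    also have "\<dots> \<le> exp 1 * exp 1"
      using exp_one_ge mult_right_mono[OF exp_one_ge exp_ge_zero[of "1::real"]] by linarith
    finally have "(exp 1 * (b - a) + 1) / (b - a) \<le> exp 1 * exp 1 / (b - a)"
      using assms by (intro divide_right_mono) auto
    then have "exp 1 + 1 / (b - a) \<le> exp 1 * exp 1 / (b - a)"
      using assms by (simp add: add_divide_distrib)
    then have "ln (exp 1 + 1 / (b - a)) \<le> ln (exp 1 * exp 1 / (b - a))"
      using assms by (subst ln_le_cancel_iff) (auto intro: add_pos_pos)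
    also have "\<dots> = 2 - ln s - ln b" using assms s by (simp add: ln_div ln_mult)
    finally have "s * ln (exp 1 + 1 / (b - a)) \<le> s * (2 - ln s - ln b)"
      using s by (intro mult_left_mono) auto
    also have "\<dots> = s * (2 - ln b) + s * (- ln s)" by (simp add: algebra_simps)
    also have "s * (2 - ln b) \<le> 2 - ln b" using s w mult_right_mono[of s 1 "2 - ln b"] by simp
    also have "s * (- ln s) \<le> 1"
    proof -
      have "- ln s \<le> 1 / s" using ln_le_minus_one[of "1 / s"] s by (simp add: ln_div)
      then have "s * (- ln s) \<le> s * (1 / s)" using s by (intro mult_left_mono) auto
      then show ?thesis using s by simp
    qed
    finally show ?thesis using w by simp
  qed
  moreover have "0 < ln (exp 1 + 1 / (b - a))"
    using assms by (intro ln_exp_one_add_pos) simp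
  ultimately have "2 * (sqrt b - sqrt a) / (sqrt b + sqrt a) \<le> 2 * s"
     "s / (1 - ln b) \<le> 3 / ln (exp 1 + 1 / (b - a))"
    using w by (simp_all add: frac_le_eq divide_le_0_iff pos_divide_le_eq pos_le_divide_eq)
  then have "2 * (sqrt b - sqrt a) / (sqrt b + sqrt a) / (1 - ln b) \<le> 2 * s / (1 - ln b)"
    using w by (intro divide_right_mono) auto
  also have "\<dots> \<le> 6 / ln (exp 1 + 1 / (b - a))"
    using \<open>s / (1 - ln b) \<le> _\<close> by simp
  finally show ?thesis .
qed

lemma subintervalsE:
  assumes "Q \<in> subintervals"
  obtains a b where "0 \<le> a" "a < b" "b \<le> 1" "{a<..<b} \<subseteq> Q" "Q \<subseteq> {a..b}"
    "Q \<in> sets lebesgue" "measure lebesgue Q = b - a"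
proof -
  define a b where "a = Inf Q" and "b = Sup Q"
  have Q: "is_interval Q" "Q \<subseteq> {0..1}" "0 < measure lebesgue Q"
    using assms by (auto simp: subintervals_def)
  then have ne: "Q \<noteq> {}" by auto
  have bdd: "bdd_above Q" "bdd_below Q"
    using Q(2) by (auto intro: bdd_above_mono bdd_below_mono)
  have sub: "Q \<subseteq> {a..b}"
    using bdd by (auto simp: a_def b_def intro: cInf_lower cSup_upper)
  have sup: "{a<..<b} \<subseteq> Q"
  proof
    fix x assume x: "x \<in> {a<..<b}"
    obtain y where "y \<in> Q" "y < x"
      using x ne bdd by (auto simp: a_def cInf_less_iff)
    moreover obtain z where "z \<in> Q" "x < z"
      using x ne bdd by (auto simp: b_def less_cSup_iff)
    ultimately show "x \<in> Q" using Q(1) unfolding is_interval_1 by (meson less_imp_le)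
  qed
  have "Q = {a<..<b} \<union> (Q \<inter> {a, b})" using sub sup by (auto simp: order.order_iff_strict)
  moreover have "\<dots> \<in> sets lebesgue"
    by (intro sets.Un) (auto intro!: sets_completionI_sets borel_closed finite_imp_closed)
  ultimately have meas: "Q \<in> sets lebesgue" by simp
  have fin: "Q \<in> lmeasurable" using meas sub  
    by (metis bounded_set_imp_lmeasurable bounded_closed_interval bounded_subset)
  have "0 \<le> a" "b \<le> 1" unfolding a_def b_def
    using Q(2) by (auto intro!: cInf_greatest[OF ne] cSup_least[OF ne])
  moreover have le: "measure lebesgue Q \<le> measure lebesgue {a..b}"
    by (rule measure_mono_fmeasurable[OF sub meas]) simp
  have "a < b" using le Q(3) by (cases "a < b") (auto simp: not_less order.order_iff_strict)
  moreover have "measure lebesgue {a<..<b} \<le> measure lebesgue Q"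
    by (rule measure_mono_fmeasurable[OF sup _ fin]) simp
  with le \<open>a < b\<close> have "measure lebesgue Q = b - a" by simp
  ultimately show ?thesis using that sub sup meas by blast
qed


lemma essinf_ge:
  assumes "f \<in> borel_measurable M" "AE x in M. c \<le> f x"
  shows "c \<le> essinf M f"
proof -
  have "esssup M (\<lambda>x. - f x) \<le> - c" using assms by (intro esssup_I) auto
  then show ?thesis unfolding essinf_def
    by (subst (asm) ereal_minus_le_minus[symmetric]) simp
qed

lemma essinf_le_esssup:
  assumes "emeasure M (space M) \<noteq> 0"
  shows "essinf M f \<le> esssup M f"
proof -
  have "AE x in M. - f x \<le> esssup M (\<lambda>x. - f x)" "AE x in M. f x \<le> esssup M f"
    by (rule esssup_AE)+
  then have "AE x in M. essinf M f \<le> esssup M f"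
  proof eventually_elim
    case (elim x)
    from elim(1) have "essinf M f \<le> f x"
      unfolding essinf_def by (subst (asm) ereal_minus_le_minus[symmetric]) simp
    with elim(2) show ?case by simp
  qed
  moreover have "\<not> trivial_limit (ae_filter M)" using assms by (simp add: ae_filter_eq_bot_iff)
  ultimately show ?thesis by (simp add: eventually_const)
qed


lemma borel_measurable_lebesgue_onI:
  "f \<in> borel_measurable borel \<Longrightarrow> f \<in> borel_measurable (lebesgue_on S)"
  by (intro measurable_restrict_space1 measurable_completion) simp

text \<open>Integrate the pointwise bound for \<open>lnln x - lnln b\<close> over the interval. The comparison is made on the
  open interval between the endpoints, where \<open>x\<close> is positive; the endpoints are negligible.\<close>

lemma avg_diff_le:
  fixes G :: "real \<Rightarrow> real"
  assumes G: "mono G" "\<And>s. 0 \<le> s \<Longrightarrow> \<bar>G s\<bar> \<le> B"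
    and lip: "\<And>s t. 0 \<le> s \<Longrightarrow> s \<le> t \<Longrightarrow> G t - G s \<le> L * (t - s)" "0 \<le> L"
    and ab: "0 \<le> a" "a < b" "b \<le> 1"
    and Q: "{a<..<b} \<subseteq> Q" "Q \<subseteq> {a..b}" "Q \<in> sets lebesgue" "measure lebesgue Q = b - a"
  shows "avg (\<lambda>x. G (lnln x)) Q - G (lnln b) \<le> 6 * L / ln (exp 1 + 1 / (b - a))"
proof -
  define f where "f x = G (lnln x)" for x
  define D where "D = 2 * (sqrt b - sqrt a) / (sqrt b + sqrt a)"
  define I where "I = (\<integral>x. f x \<partial>lebesgue_on Q)"
  have w: "1 \<le> 1 - ln b" using ab by simp
  have "Q \<in> lmeasurable"
    using Q by (metis bounded_set_imp_lmeasurable bounded_closed_interval bounded_subset)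
  then interpret finite_measure "lebesgue_on Q" by (rule finite_measure_lebesgue_on)
  have meas: "f \<in> borel_measurable (lebesgue_on Q)"
    unfolding f_def by (intro borel_measurable_lebesgue_onI borel_measurable_mono_lnln G)
  have "norm (f x) \<le> B" if "x \<in> Q" for x
    using that Q(2) ab G(2)[OF lnln_nonneg[of x]] by (auto simp: f_def)
  then have "integrable (lebesgue_on Q) f"
    by (intro integrable_const_bound[OF AE_I2 meas]) simp
  then have "(f has_integral I) Q" unfolding I_def by (rule has_integral_integral_lebesgue_on[OF _ Q(3)])
  moreover have "negligible {x \<in> Q - {a<..<b}. f x \<noteq> 0}"
    by (rule negligible_subset[of "{a, b}"]) (use Q(2) in \<open>auto simp: order.order_iff_strict\<close>)
  moreover have "{x \<in> {a<..<b} - Q. f x \<noteq> 0} = {}" using Q(1) by auto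
  ultimately have f: "(f has_integral I) {a<..<b}"
    by (subst (asm) has_integral_spike_set_eq[where T = "{a<..<b}"]) (simp_all only: negligible_empty)
  have "((\<lambda>x. f b) has_integral (b - a) * f b) {a<..<b}"
    using has_integral_const_real[of "f b" a b] ab by (simp add: has_integral_Icc_iff_Ioo)
  moreover have "((\<lambda>x. L / (1 - ln b) * (2 * (sqrt (b / x) - 1))) has_integral
      L / (1 - ln b) * ((b - a) * D)) {a<..<b}"
    unfolding D_def by (intro has_integral_mult_right has_integral_sqrt_quotient ab)
  ultimately have "((\<lambda>x. f b + L / (1 - ln b) * (2 * (sqrt (b / x) - 1))) has_integral
      (b - a) * f b + L / (1 - ln b) * ((b - a) * D)) {a<..<b}"
    by (rule has_integral_add)
  with f have "I \<le> (b - a) * f b + L / (1 - ln b) * ((b - a) * D)"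
  proof (rule has_integral_le)
    fix x assume x: "x \<in> {a<..<b}"
    have "f x - f b \<le> L * (lnln x - lnln b)"
      unfolding f_def using x ab by (intro lip lnln_nonneg lnln_antimono) auto
    also have "\<dots> \<le> L * (2 * (sqrt (b / x) - 1) / (1 - ln b))"
      using x ab by (intro mult_left_mono lnln_diff_le lip) auto
    finally show "f x \<le> f b + L / (1 - ln b) * (2 * (sqrt (b / x) - 1))" by simp
  qed
  also have "\<dots> = (b - a) * (f b + L * (D / (1 - ln b)))" by (simp add: distrib_left)
  finally have "I / (b - a) \<le> f b + L * (D / (1 - ln b))"
    using ab by (simp add: pos_divide_le_eq mult.commute)
  also have "\<dots> \<le> f b + L * (6 / ln (exp 1 + 1 / (b - a)))"
    unfolding D_def by (intro add_left_mono mult_left_mono normalized_oscillation_le ab lip)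
  finally show ?thesis by (simp add: avg_def Q(4) I_def f_def mult.commute)
qed

text \<open>Monotonicity makes the value at the right endpoint \<open>b\<close> of an interval a lower bound for the
  essential infimum, so the bound on the average minus that value suffices. The point
  \<open>0\<close> has to be discarded: there \<open>lnln\<close> takes the value \<open>0\<close> instead of growing to infinity.\<close>

lemma BLO_log_comp_lnln:
  fixes G :: "real \<Rightarrow> real"
  assumes G: "mono G" "\<And>s. 0 \<le> s \<Longrightarrow> \<bar>G s\<bar> \<le> B"
    and lip: "\<And>s t. 0 \<le> s \<Longrightarrow> s \<le> t \<Longrightarrow> G t - G s \<le> L * (t - s)" "0 < L"
  shows "(\<lambda>x. G (lnln x)) \<in> BLO_log"
proof -
  have meas: "(\<lambda>x. G (lnln x)) \<in> borel_measurable (lebesgue_on S)" for S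
    by (intro borel_measurable_lebesgue_onI borel_measurable_mono_lnln G)
  interpret finite_measure leb01 by (rule finite_measure_lebesgue_on) simp
  have "integrable leb01 (\<lambda>x. G (lnln x))"
    by (rule integrable_const_bound[OF AE_I2 meas, where B = B]) (auto intro!: G lnln_nonneg)
  moreover have "eta (\<lambda>x. G (lnln x)) r \<le> ereal (6 * L / ln (exp 1 + 1 / r))"
    if r: "0 < r" "r \<le> 1" for r
    unfolding eta_def
  proof (rule SUP_least)
    fix Q assume "Q \<in> {Q \<in> subintervals. measure lebesgue Q \<le> r}"
    then have "Q \<in> subintervals" and Qr: "measure lebesgue Q \<le> r" by auto
    then obtain a b where ab: "0 \<le> a" "a < b" "b \<le> 1"
      and Q: "{a<..<b} \<subseteq> Q" "Q \<subseteq> {a..b}" "Q \<in> sets lebesgue" "measure lebesgue Q = b - a"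
      by (elim subintervalsE)
    have "AE x in lebesgue. x \<noteq> 0"
      by (rule AE_I[where N = "{0}"]) auto
    then have "AE x in lebesgue_on Q. G (lnln b) \<le> G (lnln x)"
      using Q(2,3) ab
      by (subst AE_restrict_space_iff) (simp, erule eventually_mono,
        force intro!: monoD[OF G(1)] lnln_antimono)
    then have "ereal (G (lnln b)) \<le> essinf (lebesgue_on Q) (\<lambda>x. ereal (G (lnln x)))"
      using meas by (intro essinf_ge) auto
    then have "ereal (avg (\<lambda>x. G (lnln x)) Q) - essinf (lebesgue_on Q) (\<lambda>x. ereal (G (lnln x)))
        \<le> ereal (avg (\<lambda>x. G (lnln x)) Q - G (lnln b))"
      unfolding ereal_minus(1)[symmetric] by (rule ereal_minus_mono[OF order_refl])
    also have "\<dots> \<le> ereal (6 * L / ln (exp 1 + 1 / (b - a)))"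
      using avg_diff_le[OF G lip(1) _ ab Q] lip(2) by simp
    also have "6 * L / ln (exp 1 + 1 / (b - a)) \<le> 6 * L / ln (exp 1 + 1 / r)"
    proof (intro divide_left_mono mult_pos_pos)
      show "0 < ln (exp 1 + 1 / (b - a))" "0 < ln (exp 1 + 1 / r)" using ab r by (auto intro: ln_exp_one_add_pos)
      have "1 / r \<le> 1 / (b - a)" using Qr ab r Q(4) by (intro divide_left_mono) auto
      then show "ln (exp 1 + 1 / r) \<le> ln (exp 1 + 1 / (b - a))"
        using r by (intro ln_mono) (auto intro: add_pos_pos)
    qed (use lip in simp)
    finally show "ereal (avg (\<lambda>x. G (lnln x)) Q)
      - essinf (lebesgue_on Q) (\<lambda>x. ereal (G (lnln x))) \<le> ereal (6 * L / ln (exp 1 + 1 / r))"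
      by simp
  qed
  ultimately show ?thesis unfolding BLO_log_def using lip(2)
    by (auto intro!: exI[of _ "6 * L"])
qed

section \<open>Norms of indicators and of their maximal functions\<close>

lemma Lp_var_norm_le:
  assumes "0 < c" "modular p (\<lambda>x. \<bar>f x\<bar> / c) \<le> 1"
  shows "Lp_var_norm p f \<le> c"
  unfolding Lp_var_norm_def using assms by (intro cInf_lower bdd_belowI[of _ 0]) auto

text \<open>The infimum of an empty set of reals is unspecified; the first two premises provide a member.\<close>

lemma Lp_var_norm_ge:
  assumes "0 < c" "modular p (\<lambda>x. \<bar>f x\<bar> / c) \<le> 1"
    and "\<And>c. 0 < c \<Longrightarrow> modular p (\<lambda>x. \<bar>f x\<bar> / c) \<le> 1 \<Longrightarrow> m \<le> c"
  shows "m \<le> Lp_var_norm p f"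
  unfolding Lp_var_norm_def using assms by (intro cInf_greatest) auto

lemma maximal_fun_le_one:
  assumes "\<And>t. \<bar>f t\<bar> \<le> 1"
  shows "maximal_fun f x \<le> 1"
  unfolding maximal_fun_def
proof (rule SUP_least)
  fix Q assume "Q \<in> {Q \<in> subintervals. x \<in> Q}"
  then have Q: "Q \<in> subintervals" by simp
  then have meas: "Q \<in> sets lebesgue" by (elim subintervalsE)
  from Q have pos: "0 < measure lebesgue Q" by (simp add: subintervals_def)
  then have pos': "0 < emeasure lebesgue Q" "emeasure lebesgue Q < top"
    by (auto simp: measure_def zero_less_iff_neq_zero less_top[symmetric])
  have "(\<integral>\<^sup>+t. ennreal \<bar>f t\<bar> \<partial>lebesgue_on Q) \<le> (\<integral>\<^sup>+t. 1 \<partial>lebesgue_on Q)"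
    using assms by (intro nn_integral_mono) (simp add: ennreal_le_1)
  also have "\<dots> = emeasure lebesgue Q"
    using meas by (simp add: emeasure_restrict_space space_restrict_space)
  finally have "(\<integral>\<^sup>+t. ennreal \<bar>f t\<bar> \<partial>lebesgue_on Q) / emeasure lebesgue Q
      \<le> emeasure lebesgue Q / emeasure lebesgue Q" by (rule divide_right_mono_ennreal)
  also have "\<dots> = 1" using pos' by (auto simp: ennreal_divide_self)
  finally show "(\<integral>\<^sup>+t. ennreal \<bar>f t\<bar> \<partial>lebesgue_on Q) / emeasure lebesgue Q \<le> 1" .
qed

lemma maximal_fun_indicator_ge:
  assumes "0 < \<rho>" "\<rho> \<le> R" "R \<le> 1" "0 \<le> x" "x \<le> R"
  shows "ennreal (\<rho> / R) \<le> maximal_fun (indicator {0<..\<rho>}) x"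
proof -
  have "{0..R} \<in> {Q \<in> subintervals. x \<in> Q}"
    using assms by (auto simp: subintervals_def is_interval_cc)
  then have "(\<integral>\<^sup>+t. ennreal \<bar>indicator {0<..\<rho>} t\<bar> \<partial>lebesgue_on {0..R}) / emeasure lebesgue {0..R}
      \<le> maximal_fun (indicator {0<..\<rho>}) x"
    unfolding maximal_fun_def by (rule SUP_upper2) simp
  moreover have "(\<integral>\<^sup>+t. ennreal \<bar>indicator {0<..\<rho>} t\<bar> \<partial>lebesgue_on {0..R})
      = (\<integral>\<^sup>+t. indicator {0<..\<rho>} t \<partial>lebesgue_on {0..R})"
    by (intro nn_integral_cong) (auto simp: indicator_def)
  moreover have "\<dots> = ennreal \<rho>"
  proof -
    have "{0<..\<rho>} \<in> sets (lebesgue_on {0..R})"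
      using assms by (auto simp: sets_restrict_space_iff)
    moreover have "emeasure (lebesgue_on {0..R}) {0<..\<rho>} = ennreal \<rho>"
      using assms by (subst emeasure_restrict_space) auto
    ultimately show ?thesis by simp
  qed
  ultimately show ?thesis using assms by (simp add: divide_ennreal)
qed


text \<open>On the support of the indicator \<open>1 / p\<close> is at least \<open>G t\<close>. If \<open>1 / p\<close> were
  constantly \<open>G t\<close>, the norm would be exactly \<open>\<rho> powr G t\<close>, which is the bound claimed; larger
  values of \<open>1 / p\<close> only decrease the norm of an indicator of a set of measure at most 1.
  The support omits \<open>0\<close>, where \<open>p\<close> does not follow the general pattern.\<close>

lemma Lp_var_norm_indicator:
  fixes G :: "real \<Rightarrow> real"
  assumes G: "mono G" "\<And>s. 0 \<le> s \<Longrightarrow> 0 < G s" and t: "0 \<le> t"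
  defines "\<rho> \<equiv> exp (1 - exp t)" and "p \<equiv> \<lambda>x. 1 / G (lnln x)"
  shows "indicator {0<..\<rho>} \<in> Lp_var p"
    and "Lp_var_norm p (indicator {0<..\<rho>}) \<le> exp ((1 - exp t) * G t)"
proof -
  define c where "c = exp ((1 - exp t) * G t)"
  have \<rho>: "0 < \<rho>" "\<rho> \<le> 1" using t by (auto simp: \<rho>_def)
  have set: "{0<..\<rho>} \<in> sets leb01" using \<rho> by (auto simp: sets_restrict_space_iff)
  have "modular p (\<lambda>x. \<bar>indicator {0<..\<rho>} x\<bar> / c)
      \<le> (\<integral>\<^sup>+x. ennreal (1 / \<rho>) * indicator {0<..\<rho>} x \<partial>leb01)"
    unfolding modular_def
  proof (rule nn_integral_mono)
    fix x :: real
    show "ennreal (\<bar>\<bar>indicator {0<..\<rho>} x\<bar> / c\<bar> powr p x)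
        \<le> ennreal (1 / \<rho>) * indicator {0<..\<rho>} x"
    proof (cases "x \<in> {0<..\<rho>}")
      case True
      then have "lnln \<rho> \<le> lnln x" using \<rho> by (intro lnln_antimono) auto
      then have "t \<le> lnln x" by (simp add: \<rho>_def lnln_exp)
      then have "G t \<le> G (lnln x)" by (rule monoD[OF G(1)])
      then have "p x \<le> 1 / G t" unfolding p_def using G(2)[OF t] by (intro divide_left_mono) auto
      moreover have c: "1 / c = exp ((exp t - 1) * G t)"
        by (simp add: c_def exp_minus_inverse divide_inverse exp_minus[symmetric] algebra_simps)
      moreover have "1 \<le> exp ((exp t - 1) * G t)" using t G(2)[OF t] by simp
      ultimately have "(1 / c) powr p x \<le> (1 / c) powr (1 / G t)" by (intro powr_mono) auto
      also have "\<dots> = 1 / \<rho>"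
        unfolding c exp_powr_real using G(2)[OF t] by (simp add: \<rho>_def exp_diff)
      finally show ?thesis using True by (simp add: c_def)
    qed simp
  qed
  also have "\<dots> = ennreal (1 / \<rho>) * emeasure leb01 {0<..\<rho>}"
    using set by (simp add: nn_integral_cmult)
  also have "emeasure leb01 {0<..\<rho>} = ennreal \<rho>"
    using \<rho> by (subst emeasure_restrict_space) auto
  also have "ennreal (1 / \<rho>) * ennreal \<rho> = 1" using \<rho> by (simp add: ennreal_mult[symmetric])
  finally have mod: "modular p (\<lambda>x. \<bar>indicator {0<..\<rho>} x\<bar> / c) \<le> 1" .
  then show "Lp_var_norm p (indicator {0<..\<rho>}) \<le> exp ((1 - exp t) * G t)"
    using Lp_var_norm_le[of c] by (simp add: c_def)
  have "modular p (\<lambda>x. \<bar>indicator {0<..\<rho>} x\<bar> / c) < \<infinity>" using mod by (auto intro: le_less_trans)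
  then show "indicator {0<..\<rho>} \<in> Lp_var p"
    unfolding Lp_var_def using set by (auto simp: c_def intro!: exI[of _ c])
qed

text \<open>Only the points between \<open>r = exp (1 - exp s)\<close> and \<open>R = exp 1 * r\<close> are used. There the maximal
  function is at least \<open>\<rho> / R\<close> and \<open>1 / p\<close> is at most \<open>G s\<close>. Hence dividing by any number below
  the claimed bound produces a modular of at least \<open>(R - r) / r = exp 1 - 1 > 1\<close>.\<close>

lemma Lp_var_norm_maximal_ge:
  fixes G :: "real \<Rightarrow> real"
  assumes G: "mono G" "\<And>s. 0 \<le> s \<Longrightarrow> 0 < G s" and s: "1 \<le> s" "s \<le> t"
  defines "\<rho> \<equiv> exp (1 - exp t)" and "p \<equiv> \<lambda>x. 1 / G (lnln x)"
  shows "exp (exp s - exp t - 1 + (1 - exp s) * G s)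
    \<le> Lp_var_norm p (\<lambda>x. enn2real (maximal_fun (indicator {0<..\<rho>}) x))"
proof -
  define M where "M x = enn2real (maximal_fun (indicator {0<..\<rho>}) x)" for x
  define r R where "r = exp (1 - exp s)" and "R = exp (2 - exp s)"
  have "2 \<le> exp s" using exp_one_ge s(1) exp_le_cancel_iff[of 1 s] by linarith
  then have R: "R \<le> 1" by (simp add: R_def)
  have rR: "0 < r" "r \<le> R" "R = exp 1 * r" by (auto simp: r_def R_def exp_add[symmetric])
  have "1 - exp t \<le> 2 - exp s" using s exp_le_cancel_iff[of s t] by linarith
  then have \<rho>: "0 < \<rho>" "\<rho> \<le> R" by (simp_all add: \<rho>_def R_def)
  have fin: "maximal_fun (indicator {0<..\<rho>}) x \<le> 1" for x
    by (rule maximal_fun_le_one) (simp add: indicator_def)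
  have M01: "0 \<le> M x" "M x \<le> 1" for x
    using enn2real_mono[OF fin, of x] by (auto simp: M_def)
  have M_ge: "\<rho> / R \<le> M x" if "0 \<le> x" "x \<le> R" for x
    using enn2real_mono[OF maximal_fun_indicator_ge[OF \<rho> R that]] fin[of x] \<rho> rR
    by (simp add: M_def order_le_less_trans)
  have p_pos: "0 < p x" if "x \<in> {0..1}" for x
    using that G(2)[OF lnln_nonneg[of x]] by (simp add: p_def)
  show ?thesis
    unfolding M_def[symmetric]
  proof (rule Lp_var_norm_ge[of 1])
    \<comment> \<open>The maximal function of an indicator is at most 1, so 1 itself is an admissible constant.\<close>
    have "modular p (\<lambda>x. \<bar>M x\<bar> / 1) \<le> (\<integral>\<^sup>+x. 1 \<partial>leb01)"
      unfolding modular_def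
      using M01 p_pos by (intro nn_integral_mono) (auto simp: ennreal_le_1 less_imp_le intro!: powr_le1)
    also have "\<dots> = 1" by (simp add: emeasure_restrict_space)
    finally show "modular p (\<lambda>x. \<bar>M x\<bar> / 1) \<le> 1" .
  next
    fix c :: real assume c: "0 < c" and mod: "modular p (\<lambda>x. \<bar>M x\<bar> / c) \<le> 1"
    define m where "m = exp (exp s - exp t - 1 + (1 - exp s) * G s)"
    have Gs: "0 < G s" using G(2) s by simp
    have m: "\<rho> / R / m = exp ((exp s - 1) * G s)"
      unfolding m_def \<rho>_def R_def exp_diff[symmetric] by (simp add: algebra_simps)
    show "m \<le> c"
    proof (rule ccontr)
      assume "\<not> m \<le> c"
      then have "c < m" by simp
      have "ennreal (exp 1 - 1) = ennreal (1 / r) * ennreal (R - r)"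
        using rR by (simp add: ennreal_mult[symmetric] field_simps)
      also have "\<dots> = ennreal (1 / r) * emeasure leb01 {r..R}"
        using rR R by (subst emeasure_restrict_space) auto
      also have "\<dots> = (\<integral>\<^sup>+x. ennreal (1 / r) * indicator {r..R} x \<partial>leb01)"
        using rR R by (subst nn_integral_cmult_indicator) (auto simp: sets_restrict_space_iff)
      also have "\<dots> \<le> modular p (\<lambda>x. \<bar>M x\<bar> / c)"
        unfolding modular_def
      proof (rule nn_integral_mono)
        fix x :: real
        show "ennreal (1 / r) * indicator {r..R} x \<le> ennreal (\<bar>\<bar>M x\<bar> / c\<bar> powr p x)"
        proof (cases "x \<in> {r..R}")
          case True
          then have x: "0 < x" "x \<le> 1" using rR R by auto
          have "lnln x \<le> lnln r" using True rR x by (intro lnln_antimono) auto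
          then have "lnln x \<le> s" by (simp add: r_def lnln_exp)
          then have "G (lnln x) \<le> G s" by (rule monoD[OF G(1)])
          then have p: "1 / G s \<le> p x"
            unfolding p_def using x Gs G(2)[OF lnln_nonneg[of x]] by (intro divide_left_mono) auto
          have "\<rho> / R / m \<le> M x / c"
            using \<open>c < m\<close> c M_ge[of x] True rR M01[of x] \<rho> by (intro frac_le) auto
          then have ge: "exp ((exp s - 1) * G s) \<le> M x / c" unfolding m .
          moreover have "1 \<le> exp ((exp s - 1) * G s)" using s Gs by simp
          ultimately have "1 \<le> M x / c" by linarith
          then have "(M x / c) powr (1 / G s) \<le> (M x / c) powr p x" by (intro powr_mono p)
          moreover have "exp ((exp s - 1) * G s) powr (1 / G s) \<le> (M x / c) powr (1 / G s)"
            using ge Gs by (intro powr_mono2) simp_all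
          moreover have "exp ((exp s - 1) * G s) powr (1 / G s) = 1 / r"
            unfolding exp_powr_real using Gs by (simp add: r_def exp_diff)
          ultimately have "1 / r \<le> (M x / c) powr p x" by linarith
          moreover have "\<bar>\<bar>M x\<bar> / c\<bar> = M x / c" using M01[of x] c by simp
          ultimately show ?thesis using True by (simp only: indicator_simps mult_1_right ennreal_leI)
        qed simp
      qed
      also note mod
      finally show False using exp_one_ge by (simp add: ennreal_le_1)
    qed
  qed simp
qed

text \<open>Compare the lower bound for the maximal function of the indicator with the upper bound for the
  indicator itself, and take logarithms.\<close>

lemma maximal_bounded_imp_bounded_drop:
  fixes G :: "real \<Rightarrow> real"
  assumes G: "mono G" "\<And>s. 0 \<le> s \<Longrightarrow> 0 < G s" "\<And>s. 0 \<le> s \<Longrightarrow> G s \<le> 1"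
    and bounded: "maximal_bounded (\<lambda>x. 1 / G (lnln x))"
  obtains K where "\<And>s t. 1 \<le> s \<Longrightarrow> s \<le> t \<Longrightarrow> exp s * (1 - G s) - exp t * (1 - G t) \<le> K"
proof -
  obtain C where C: "0 < C" "\<And>f. f \<in> Lp_var (\<lambda>x. 1 / G (lnln x)) \<Longrightarrow>
      Lp_var_norm (\<lambda>x. 1 / G (lnln x)) (\<lambda>x. enn2real (maximal_fun f x))
        \<le> C * Lp_var_norm (\<lambda>x. 1 / G (lnln x)) f"
    using bounded unfolding maximal_bounded_def by blast
  have "exp s * (1 - G s) - exp t * (1 - G t) \<le> ln C + 2" if st: "1 \<le> s" "s \<le> t" for s t
  proof -
    have t: "0 \<le> t" using st by simp
    note ind = Lp_var_norm_indicator[OF G(1,2) t]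
    have "exp (exp s - exp t - 1 + (1 - exp s) * G s) \<le> C * exp ((1 - exp t) * G t)"
      using Lp_var_norm_maximal_ge[OF G(1,2) st] C(2)[OF ind(1)] mult_left_mono[OF ind(2), of C] C(1)
      by linarith
    also have "\<dots> = exp (ln C + (1 - exp t) * G t)" using C(1) by (simp add: exp_add)
    finally have "exp s - exp t - 1 + (1 - exp s) * G s \<le> ln C + (1 - exp t) * G t" by simp
    moreover have "G t \<le> 1" "0 < G s" using G st by auto
    ultimately show ?thesis by (simp add: algebra_simps)
  qed
  then show ?thesis using that by blast
qed

section \<open>The counterexample\<close>

theorem corollary1p4:
  shows "\<exists>p :: real \<Rightarrow> real.
    exponent p \<and> 1 < p_minus p \<and> p_minus p \<le> p_plus p \<and> p_plus p < \<infinity> \<and>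
    (\<lambda>x. 1 / p x) \<in> BLO_log \<and> p \<notin> class_B"
proof (intro exI conjI)
  define p where "p x = 1 / climb (lnln x)" for x
  have meas: "p \<in> borel_measurable leb01"
    unfolding p_def
    by (intro borel_measurable_divide borel_measurable_const borel_measurable_lebesgue_onI
        borel_measurable_mono_lnln mono_climb)
  have p: "4/3 \<le> p x" "p x \<le> 4" if "x \<in> {0..1}" for x
  proof -
    have "1/4 \<le> climb (lnln x)" using that by (intro climb_ge_quarter lnln_nonneg) auto
    then show "4/3 \<le> p x" "p x \<le> 4" using climb_le[of "lnln x"] by (auto simp: p_def field_simps)
  qed
  show "exponent p" unfolding exponent_def using meas p by force
  have "ereal (4/3) \<le> p_minus p"
    unfolding p_minus_def using meas p by (intro essinf_ge AE_I2) auto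
  moreover have "(1::ereal) < ereal (4/3)" by simp
  ultimately show "1 < p_minus p" by (rule less_le_trans[rotated])
  show "p_minus p \<le> p_plus p"
    unfolding p_minus_def p_plus_def
    by (rule essinf_le_esssup) (simp add: emeasure_restrict_space)
  have "p_plus p \<le> ereal 4"
    unfolding p_plus_def using meas p by (intro esssup_I AE_I2) auto
  then show "p_plus p < \<infinity>" by (rule le_less_trans) simp
  have "(\<lambda>x. climb (lnln x)) \<in> BLO_log"
  proof (rule BLO_log_comp_lnln[OF mono_climb])
    show "\<bar>climb s\<bar> \<le> 1" if "0 \<le> s" for s
      using climb_ge_quarter[OF that] climb_le[of s] by simp
    show "climb t - climb s \<le> 4 * (t - s)" if "s \<le> t" for s t
      using climb_lipschitz[OF that] by simp
  qed simp
  then show "(\<lambda>x. 1 / p x) \<in> BLO_log" by (simp add: p_def)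
  show "p \<notin> class_B"
  proof
    assume "p \<in> class_B"
    then have "maximal_bounded (\<lambda>x. 1 / climb (lnln x))" by (simp add: class_B_def p_def[abs_def])
    moreover have "0 < climb s" "climb s \<le> 1" if "0 \<le> s" for s
      using climb_ge_quarter[OF that] climb_le[of s] by auto
    ultimately obtain K where
      "\<And>s t. 1 \<le> s \<Longrightarrow> s \<le> t \<Longrightarrow> exp s * (1 - climb s) - exp t * (1 - climb t) \<le> K"
      using maximal_bounded_imp_bounded_drop[OF mono_climb] by metis
    then show False by (metis climb_drop not_le)
  qed
qed

end
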